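(* For $m\in\mathbb{N}$ let $\mathcal{A}(m)=\{(1,0),(1,1),(m,m+1)\}\subset\mathbb{Z}^2$, let $w=(1,1,1)$, and let $\mathcal{A}(m)_w=\{(1,0,1),(1,1,1),(m,m+1,1),(0,0,1)\}\subset\mathbb{Z}^3$. Then the semigroup $\mathbb{N}\mathcal{A}(m)_w$ is not saturated for all $m\geq3$.
   Context: $\mathbb{N}$ contains $0$. For a finite set $\mathcal{B}\subset\mathbb{Z}^k$, $\mathbb{N}\mathcal{B}$ is the submonoid of $\mathbb{Z}^k$ generated by $\mathcal{B}$. The semigroup $S=\mathbb{N}\mathcal{B}$ is saturated if $S=\overline{S}$, where $\overline{S}:=\mathbb{R}_{\geq0}S\cap\mathbb{Z}^k$ and $\mathbb{R}_{\geq 0}S$ is the cone of nonnegative real linear combinations of elements of $S$. *)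

theory Defs
  imports "HOL-Analysis.Analysis"
begin

definition submonoid :: "'a::comm_monoid_add set \<Rightarrow> bool" where
  "submonoid M \<longleftrightarrow> 0 \<in> M \<and> (\<forall>x\<in>M. \<forall>y\<in>M. x + y \<in> M)"

definition generated_monoid :: "'a::comm_monoid_add set \<Rightarrow> 'a set" where
  "generated_monoid B = submonoid hull B"

definition real_vec :: "int ^ 'k \<Rightarrow> real ^ 'k" where
  "real_vec z = (\<chi> i. real_of_int (z $ i))"

definition nonneg_cone :: "'a::real_vector set \<Rightarrow> 'a set" where
  "nonneg_cone X = {\<Sum>x\<in>F. c x *\<^sub>R x | F c. finite F \<and> F \<subseteq> X \<and> (\<forall>x\<in>F. 0 \<le> c x)}"

definition saturation :: "(int ^ 'k) set \<Rightarrow> (int ^ 'k) set" where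
  "saturation S = {z. real_vec z \<in> nonneg_cone (real_vec ` S)}"

definition saturated :: "(int ^ 'k) set \<Rightarrow> bool" where
  "saturated S \<longleftrightarrow> S = saturation S"

definition config :: "nat \<Rightarrow> (int ^ 2) set" where
  "config m = {vector [1, 0], vector [1, 1], vector [int m, int m + 1]}"

definition config_w :: "nat \<Rightarrow> (int ^ 3) set" where
  "config_w m =
    {vector [1, 0, 1], vector [1, 1, 1], vector [int m, int m + 1, 1], vector [0, 0, 1]}"

text \<open>Since all entries of the weight \<open>w = (1, 1, 1)\<close> are equal, every vector of
  \<open>config m\<close> gets the same last coordinate 1, whatever the order of the vectors.\<close>

lemma config_w_eq_lift:
  "config_w m = (\<lambda>a. vector [a $ 1, a $ 2, 1]) ` config m \<union> {vector [0, 0, 1]}"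
  by (auto simp: config_w_def config_def)

end

theory Submission imports Defs begin

text \<open>The lattice point \<open>(2, 2, 1)\<close> is a hole: every element of the semigroup at height 1 is a
  generator, so \<open>(2, 2, 1)\<close> is not one of them, while for \<open>m \<ge> 3\<close> the point \<open>(2, 2)\<close> lies in the
  triangle with vertices \<open>(0, 0)\<close>, \<open>(1, 0)\<close>, \<open>(m, m + 1)\<close>, where its barycentric coordinates are
  \<open>(m - 3) / (m + 1)\<close>, \<open>2 / (m + 1)\<close>, \<open>2 / (m + 1)\<close>.\<close>

lemma vector_3_eq_iff:
  "vector [a, b, c] = (vector [x, y, z] :: 'a::zero ^ 3) \<longleftrightarrow> a = x \<and> b = y \<and> c = z"
  by (simp add: vec_eq_iff forall_3)

lemma real_vec_vector_3:
  "real_vec (vector [a, b, c] :: int ^ 3) = vector [real_of_int a, real_of_int b, real_of_int c]"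
  by (simp add: real_vec_def vec_eq_iff forall_3)

lemma generated_monoid_superset: "B \<subseteq> generated_monoid B"
  unfolding generated_monoid_def by (rule hull_subset)

lemma generated_monoid_minimal: "B \<subseteq> M \<Longrightarrow> submonoid M \<Longrightarrow> generated_monoid B \<subseteq> M"
  unfolding generated_monoid_def by (rule hull_minimal)

text \<open>Adding two vectors of height (coordinate \<open>i\<close>) at least 1 gives height at
  least 2. Hence 0, \<open>B\<close> and everything of height at least 2 form a submonoid, whose
  only elements of height 1 lie in \<open>B\<close>.\<close>

lemma generated_monoid_height_one:
  fixes B :: "(int ^ 'k) set"
  assumes height: "\<And>b. b \<in> B \<Longrightarrow> b $ i = 1"
    and z: "z \<in> generated_monoid B" "z $ i = 1"
  shows "z \<in> B"
proof -
  let ?M = "insert 0 (B \<union> {v. 2 \<le> v $ i})"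
  have pos: "v = 0 \<or> 1 \<le> v $ i" if "v \<in> ?M" for v
    using that height by force
  have "submonoid ?M"
    unfolding submonoid_def
  proof (intro conjI ballI)
    fix x y assume xy: "x \<in> ?M" "y \<in> ?M"
    then consider "x = 0" | "y = 0" | "1 \<le> x $ i" "1 \<le> y $ i"
      using pos by blast
    then show "x + y \<in> ?M"
      using xy by cases auto
  qed simp
  then have "generated_monoid B \<subseteq> ?M"
    by (intro generated_monoid_minimal) auto
  with z show ?thesis by auto
qed

text \<open>\<open>nonneg_cone\<close> takes its coefficients from a function on vectors;
  distinctness lets \<open>?c\<close> give each of the three vectors its own value.\<close>

lemma nonneg_cone_combination_3:
  assumes "x \<in> X" "y \<in> X" "z \<in> X" and "distinct [x, y, z]"
    and "0 \<le> a" "0 \<le> b" "0 \<le> c"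
  shows "a *\<^sub>R x + b *\<^sub>R y + c *\<^sub>R z \<in> nonneg_cone X"
proof -
  let ?c = "(\<lambda>_. c)(x := a, y := b)"
  have "a *\<^sub>R x + b *\<^sub>R y + c *\<^sub>R z = (\<Sum>v\<in>{x, y, z}. ?c v *\<^sub>R v)"
    using assms(4) by (auto simp: add.assoc)
  moreover have "\<forall>v\<in>{x, y, z}. 0 \<le> ?c v"
    using assms(5-7) by simp
  moreover have "finite {x, y, z}" "{x, y, z} \<subseteq> X"
    using assms(1-3) by auto
  ultimately show ?thesis
    unfolding nonneg_cone_def by blast
qed

theorem proposition3p3:
  fixes m :: nat
  assumes "3 \<le> m"
  shows "\<not> saturated (generated_monoid (config_w m))"
proof -
  let ?S = "generated_monoid (config_w m)"
  let ?p = "vector [2, 2, 1] :: int ^ 3"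
  let ?o = "vector [0, 0, 1] :: int ^ 3"
  let ?a = "vector [1, 0, 1] :: int ^ 3"
  let ?c = "vector [int m, int m + 1, 1] :: int ^ 3"
  have "?p \<notin> config_w m"
    using assms by (auto simp: config_w_def vector_3_eq_iff)
  moreover have "b $ 3 = 1" if "b \<in> config_w m" for b
    using that by (auto simp: config_w_def)
  ultimately have "?p \<notin> ?S"
    using generated_monoid_height_one[of "config_w m" 3 ?p] by auto
  moreover have "?p \<in> saturation ?S"
  proof -
    let ?t = "2 / (real m + 1)" and ?u = "(real m - 3) / (real m + 1)"
    have "?o \<in> ?S" "?a \<in> ?S" "?c \<in> ?S"
      using generated_monoid_superset[of "config_w m"] by (auto simp: config_w_def)
    moreover have "distinct [real_vec ?o, real_vec ?a, real_vec ?c]"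
      using assms by (simp add: real_vec_vector_3 vector_3_eq_iff)
    \<comment> \<open>Here \<open>3 \<le> m\<close> is what makes \<open>?u\<close>
      nonnegative.\<close>
    ultimately have "?u *\<^sub>R real_vec ?o + ?t *\<^sub>R real_vec ?a + ?t *\<^sub>R real_vec ?c
        \<in> nonneg_cone (real_vec ` ?S)"
      using assms by (intro nonneg_cone_combination_3) auto
    also have "?u *\<^sub>R real_vec ?o + ?t *\<^sub>R real_vec ?a + ?t *\<^sub>R real_vec ?c = real_vec ?p"
    proof -
      have "real m + 1 \<noteq> 0" by linarith
      \<comment> \<open>These are the three coordinates of the claimed vector identity, in
        order.\<close>
      then have "?t + ?t * real m = 2" "?t * (real m + 1) = 2" "?u + ?t + ?t = 1"
        by (simp_all add: divide_simps) (simp_all add: algebra_simps)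
      then show ?thesis
        by (simp add: real_vec_vector_3 vec_eq_iff forall_3)
    qed
    finally show ?thesis
      by (simp add: saturation_def)
  qed
  ultimately show ?thesis
    unfolding saturated_def by blast
qed

end
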